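(* For every Korselt number ($KN$), $r\le \frac12(P-1)(P+1)^2+1$, with equality if and only if $q=P^2+P-1$.
   Context: A Korselt number ($KN$) is an integer $n$ together with a factorisation $n=\prod_{i=1}^d p_i$, where $d\ge 3$ and $1<p_1<p_2<\dots<p_d$ are odd integers (not necessarily prime), such that $p_i-1$ divides $n-1$ for every $i$, and such that $E:=\dfrac{n/p_d-1}{p_d-1}$ (which is an integer by the divisibility condition) satisfies $E\ge 2$. Notation: $P:=\prod_{i=1}^{d-2}p_i$, $q:=p_{d-1}$, $r:=p_d$, so that $n=Pqr$. *)

theory Defs
  imports Complex_Main
begin

text \<open>
  The factorisation is part of the data: the factors are \<open>p 1, ..., p d\<close>, and the values of
  \<open>p\<close> outside \<open>{1..d}\<close> are irrelevant.
\<close>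

definition korselt_E :: "int \<Rightarrow> nat \<Rightarrow> (nat \<Rightarrow> int) \<Rightarrow> int" where
  "korselt_E n d p = (n div p d - 1) div (p d - 1)"

definition korselt_number :: "int \<Rightarrow> nat \<Rightarrow> (nat \<Rightarrow> int) \<Rightarrow> bool" where
  "korselt_number n d p \<longleftrightarrow>
     3 \<le> d \<and>
     (\<forall>i\<in>{1..d}. 1 < p i \<and> odd (p i)) \<and>
     strict_mono_on {1..d} p \<and>
     n = (\<Prod>i=1..d. p i) \<and>
     (\<forall>i\<in>{1..d}. (p i - 1) dvd (n - 1)) \<and>
     2 \<le> korselt_E n d p"

text \<open>Both integer divisions in \<^const>\<open>korselt_E\<close> are exact for a Korselt number.\<close>

lemma korselt_E_exact:
  assumes "korselt_number n d p"
  shows "p d dvd n" and "(p d - 1) dvd (n div p d - 1)"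
proof -
  have d: "d \<in> {1..d}" and n: "n = (\<Prod>i=1..d. p i)"
    using assms by (auto simp: korselt_number_def)
  show 1: "p d dvd n"
    unfolding n by (rule dvd_prodI) (use d in auto)
  define m where "m = n div p d"
  have m: "n = m * p d" using 1 by (simp add: m_def)
  have "(p d - 1) dvd (n - 1)" using assms d by (auto simp: korselt_number_def)
  moreover have "n - 1 = m * (p d - 1) + (m - 1)" by (simp add: m algebra_simps)
  ultimately have "(p d - 1) dvd (m - 1)"
    by (metis dvd_add_right_iff dvd_triv_right)
  then show "(p d - 1) dvd (n div p d - 1)"
    unfolding m_def .
qed

end

theory Submission
  imports Defs
begin

text \<open>
  Write \<open>P q - 1 = E (r - 1)\<close> and \<open>P r - 1 = D (q - 1)\<close>. Eliminating \<open>r\<close> gives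
  \<open>C (q - 1) = (P - 1) (P + E)\<close> with \<open>C = E D - P\<^sup>2\<close>, which is positive since the right-hand
  side is. Hence \<open>r - 1 = (P - 1) (P\<^sup>2 / (E C) + P / C + 1 / E)\<close>, which is largest exactly for
  \<open>E = 2\<close> and \<open>C = 1\<close>, and there \<open>q - 1 = (P - 1) (P + 2)\<close>.
\<close>

lemma dvd_mult_minus_one_iff:
  fixes a b :: "'a::comm_ring_1"
  shows "b - 1 dvd a * b - 1 \<longleftrightarrow> b - 1 dvd a - 1"
proof -
  have "a * b - 1 = a * (b - 1) + (a - 1)" by (simp add: algebra_simps)
  then show ?thesis by (metis dvd_add_right_iff dvd_triv_right)
qed

text \<open>The arithmetic core over the integers: the divisibility conditions at \<open>r\<close>
  and \<open>q\<close> become equations with cofactors \<open>E\<close> and \<open>D\<close>, and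
  the bound is doubled to clear the factor 1/2.\<close>

lemma largest_factor_bound:
  fixes P q r E D :: int
  assumes P: "1 < P" and q: "1 < q" and qr: "q < r" and E: "2 \<le> E"
    and PqE: "P * q - 1 = E * (r - 1)" and PrD: "P * r - 1 = D * (q - 1)"
  shows "2 * (r - 1) \<le> (P - 1) * (P + 1)\<^sup>2"
    and "2 * (r - 1) = (P - 1) * (P + 1)\<^sup>2 \<longleftrightarrow> q = P\<^sup>2 + P - 1"
proof -
  define C where "C = E * D - P\<^sup>2"
  have C: "C * (q - 1) = (P - 1) * (P + E)"
  proof -
    have "E * D * (q - 1) = E * (P * r - 1)"
      by (simp add: PrD mult.assoc)
    also have "\<dots> = P * (P * q - 1) + E * (P - 1)"
      unfolding PqE by (simp add: algebra_simps)
    finally show ?thesis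
      unfolding C_def by (simp add: algebra_simps power2_eq_square)
  qed
  then have "0 < C * (q - 1)" using P E by simp
  then have C1: "1 \<le> C" using q by (simp add: zero_less_mult_iff)
  \<comment> \<open>\<open>G\<close> is the cofactor of \<open>P - 1\<close> in \<open>E * C\<close>
    times the gap between the two sides of the bound, grouped so that each summand is nonnegative
    for \<open>E\<close> \<ge> 2 and \<open>C\<close> \<ge> 1.\<close>
  define G where "G = (E * C - 2) * P\<^sup>2 + 2 * P * E * (C - 1) + C * (E - 2)"
  have gap: "E * C * ((P - 1) * (P + 1)\<^sup>2 - 2 * (r - 1)) = (P - 1) * G"
  proof -
    have "E * C * (2 * (r - 1)) = 2 * C * (P * q - 1)"
      unfolding PqE by (simp add: algebra_simps)
    also have "\<dots> = 2 * P * (C * (q - 1)) + 2 * C * (P - 1)"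
      by (simp add: algebra_simps)
    also have "\<dots> = 2 * (P - 1) * (P * (P + E) + C)"
      unfolding C by (simp add: algebra_simps)
    finally show ?thesis
      unfolding G_def right_diff_distrib[of "E * C"]
      by (simp add: algebra_simps power2_eq_square)
  qed
  have EC: "2 \<le> E * C"
    using mult_mono[of 2 E 1 C] E C1 by simp
  have G_terms: "0 \<le> (E * C - 2) * P\<^sup>2" "0 \<le> 2 * P * E * (C - 1)" "0 \<le> C * (E - 2)"
    using P E C1 EC by simp_all
  then have "0 \<le> (P - 1) * G" using P by (simp add: G_def)
  then show "2 * (r - 1) \<le> (P - 1) * (P + 1)\<^sup>2"
    using EC unfolding gap[symmetric] by (simp add: zero_le_mult_iff)
  \<comment> \<open>This follows from \<open>q\<close> \<le> \<open>r - 1\<close>; it excludes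
    \<open>C\<close> \<ge> 2 in the equality case below.\<close>
  have "E < P"
  proof (rule ccontr)
    assume "\<not> E < P"
    then have "P * q \<le> E * (r - 1)" using P q qr by (intro mult_mono) auto
    then show False using PqE by simp
  qed
  have "2 * (r - 1) = (P - 1) * (P + 1)\<^sup>2 \<longleftrightarrow> G = 0"
    using gap EC P by auto
  \<comment> \<open>All three summands of \<open>G\<close> must vanish; the second forces
    \<open>C = 1\<close>, the third \<open>E = 2\<close>.\<close>
  also have "\<dots> \<longleftrightarrow> C = 1 \<and> E = 2"
    using G_terms C1 P E unfolding G_def by (auto simp: add_nonneg_eq_0_iff)
  \<comment> \<open>The right-hand side is the relation \<open>C\<close> for
    \<open>q - 1 = (P - 1) * (P + 2)\<close>, with \<open>P - 1\<close> cancelled. If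
    \<open>C\<close> \<ge> 2, it would give 2P + 4 \<le> P + E < 2P.\<close>
  also have "\<dots> \<longleftrightarrow> C * (P + 2) = P + E"
  proof
    assume *: "C * (P + 2) = P + E"
    have "C < 2"
    proof (rule ccontr)
      assume "\<not> C < 2"
      then have "2 * (P + 2) \<le> C * (P + 2)" using P by (intro mult_right_mono) auto
      then show False using * \<open>E < P\<close> by simp
    qed
    then have "C = 1" using C1 by simp
    then show "C = 1 \<and> E = 2" using * by simp
  qed simp
  also have "\<dots> \<longleftrightarrow> C * ((P - 1) * (P + 2)) = C * (q - 1)"
    unfolding C using P by (simp add: mult.left_commute)
  also have "\<dots> \<longleftrightarrow> q = P\<^sup>2 + P - 1"
  proof -
    have "(P - 1) * (P + 2) = P\<^sup>2 + P - 2" by (simp add: algebra_simps power2_eq_square)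
    then show ?thesis using C1 by auto
  qed
  finally show "2 * (r - 1) = (P - 1) * (P + 1)\<^sup>2 \<longleftrightarrow> q = P\<^sup>2 + P - 1" .
qed

theorem theorem3p2:
  fixes n P q r :: int and d :: nat and p :: "nat \<Rightarrow> int"
  assumes "korselt_number n d p"
    and "P = (\<Prod>i=1..d - 2. p i)"
    and "q = p (d - 1)"
    and "r = p d"
  shows "real_of_int r \<le> 1 / 2 * (real_of_int P - 1) * (real_of_int P + 1)\<^sup>2 + 1 \<and>
    (real_of_int r = 1 / 2 * (real_of_int P - 1) * (real_of_int P + 1)\<^sup>2 + 1
       \<longleftrightarrow> q = P\<^sup>2 + P - 1)"
proof -
  have d: "3 \<le> d" and p: "\<And>i. i \<in> {1..d} \<Longrightarrow> 1 < p i" and mono: "strict_mono_on {1..d} p"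
    and n: "n = (\<Prod>i=1..d. p i)" and dvd: "\<And>i. i \<in> {1..d} \<Longrightarrow> p i - 1 dvd n - 1"
    and E2: "2 \<le> korselt_E n d p"
    using assms(1) unfolding korselt_number_def by auto
  \<comment> \<open>This form of \<open>d\<close> lets the product split off \<open>q\<close> and
    \<open>r\<close>; \<open>k\<close> \<ge> 1 keeps the product \<open>P\<close> nonempty, hence
    above 1.\<close>
  obtain k where k: "d = Suc (Suc k)" "1 \<le> k"
    using d by (cases d rule: nat.exhaust; cases "d - 1") auto
  have nP: "n = P * q * r" using n assms(2-4) k by (simp add: prod.cl_ivl_Suc)
  have P: "1 < P" unfolding assms(2) using k p by (intro less_1_prod) auto
  have q: "1 < q" and qr: "q < r"
    using assms(3,4) p k strict_mono_onD[OF mono, of "d - 1" d] by auto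
  have "r \<noteq> 0" using q qr by simp
  then have nr: "n div r = P * q" by (simp add: nP)
  have "P * q - 1 = korselt_E n d p * (r - 1)"
    using korselt_E_exact(2)[OF assms(1)] unfolding korselt_E_def assms(4)[symmetric] nr by simp
  moreover have "q - 1 dvd P * r * q - 1"
    using dvd[of "d - 1"] d unfolding assms(3)[symmetric] nP by (simp add: mult_ac)
  then have "q - 1 dvd P * r - 1" by (simp only: dvd_mult_minus_one_iff)
  then obtain D where "P * r - 1 = D * (q - 1)" by (metis dvdE mult.commute)
  ultimately have bound: "2 * (r - 1) \<le> (P - 1) * (P + 1)\<^sup>2"
      "2 * (r - 1) = (P - 1) * (P + 1)\<^sup>2 \<longleftrightarrow> q = P\<^sup>2 + P - 1"
    using largest_factor_bound[OF P q qr E2] by blast+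
  have cast: "1 / 2 * (real_of_int P - 1) * (real_of_int P + 1)\<^sup>2 + 1
      = real_of_int ((P - 1) * (P + 1)\<^sup>2) / 2 + 1"
    by simp
  \<comment> \<open>The real statements are brought back to the doubled integer ones.\<close>
  have "real_of_int r \<le> real_of_int m / 2 + 1 \<longleftrightarrow> 2 * (r - 1) \<le> m"
    and "real_of_int r = real_of_int m / 2 + 1 \<longleftrightarrow> 2 * (r - 1) = m" for m
    unfolding of_int_le_iff[of _ m, where ?'a = real, symmetric]
      of_int_eq_iff[of _ m, where ?'a = real, symmetric] by (auto simp: field_simps)
  then show ?thesis unfolding cast using bound by blast
qed

end
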